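(* Let $\mathcal X,\mathcal Z$ be Banach spaces, $E\in\mathcal L(\mathcal X,\mathcal Z)$, $A\colon\mathcal D(A)\subseteq\mathcal X\to\mathcal Z$ closed, linear and densely defined, with $\rho(E,A)\neq\emptyset$. If the radiality index $p_{\rm rad}^{(E,A)}$ exists, then the resolvent index $p_{\rm res}^{(E,A)}$ also exists and $p_{\rm rad}^{(E,A)}+1\ge p_{\rm res}^{(E,A)}$. Likewise, if the complex radiality index $p_{\rm c,rad}^{(E,A)}$ exists, then the complex resolvent index $p_{\rm c,res}^{(E,A)}$ also exists and $p_{\rm c,rad}^{(E,A)}+1\ge p_{\rm c,res}^{(E,A)}$.
   Context: $\rho(E,A)$ is the set of $\lambda\in\mathbb C$ for which $\lambda E-A\colon\mathcal D(A)\to\mathcal Z$ has an inverse $(\lambda E-A)^{-1}\in\mathcal L(\mathcal Z,\mathcal X)$. Write $\mathbb C_{\mathrm{Re}>\omega}=\{\lambda\in\mathbb C:\mathrm{Re}\,\lambda>\omega\}$. Resolvent index: the smallest $p\in\mathbb N_0$ such that there are $\omega\in\mathbb R$, $C>0$ with $(\omega,\infty)\subseteq\rho(E,A)$ and $\|(\lambda E-A)^{-1}\|\le C|\lambda|^{p-1}$ for all $\lambda\in(\omega,\infty)$. The complex resolvent index is defined in the same way with $(\omega,\infty)$ replaced by $\mathbb C_{\mathrm{Re}>\omega}$ throughout. Radiality index: the smallest $p\in\mathbb N_0$ such that there are $\omega\in\mathbb R$, $C>0$ with $(\omega,\infty)\subseteq\rho(E,A)$ and, for all $\lambda_0,\dots,\lambda_p\in(\omega,\infty)$,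 both $\|(\lambda_0E-A)^{-1}E\cdots(\lambda_pE-A)^{-1}E\|$ and $\|E(\lambda_0E-A)^{-1}\cdots E(\lambda_pE-A)^{-1}\|$ are at most $C\prod_{k=0}^p\frac1{|\lambda_k-\omega|}$. The complex radiality index is defined in the same way with $(\omega,\infty)$ replaced by $\mathbb C_{\mathrm{Re}>\omega}$ throughout. *)

theory Defs
  imports "HOL-Analysis.Analysis"
begin

text \<open>Complex normed spaces are real normed spaces with a compatible complex scalar
  multiplication, so the norm, topology and completeness (class \<open>banach\<close>) are those of HOL-Analysis.\<close>

class scaleC =
  fixes scaleC :: "complex \<Rightarrow> 'a \<Rightarrow> 'a" (infixr "*\<^sub>C" 75)

class complex_normed_vector = real_normed_vector + scaleC +
  assumes scaleC_add_right: "c *\<^sub>C (x + y) = c *\<^sub>C x + c *\<^sub>C y"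
    and scaleC_add_left: "(c + d) *\<^sub>C x = c *\<^sub>C x + d *\<^sub>C x"
    and scaleC_scaleC: "c *\<^sub>C d *\<^sub>C x = (c * d) *\<^sub>C x"
    and scaleC_of_real: "complex_of_real r *\<^sub>C x = r *\<^sub>R x"
    and norm_scaleC: "norm (c *\<^sub>C x) = cmod c * norm x"

instantiation complex :: complex_normed_vector
begin

definition scaleC_complex :: "complex \<Rightarrow> complex \<Rightarrow> complex"
  where "scaleC_complex c z = c * z"

instance
  by standard (simp_all add: scaleC_complex_def algebra_simps norm_mult scaleR_conv_of_real)

end

global_interpretation complex_vector:
  vector_space "scaleC :: complex \<Rightarrow> 'a \<Rightarrow> 'a::complex_normed_vector"
proof
  fix x :: 'a
  show "1 *\<^sub>C x = x"
    using scaleC_of_real[of 1 x] by simp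
qed (simp_all add: scaleC_add_right scaleC_add_left scaleC_scaleC)

definition bounded_clinear :: "('x::complex_normed_vector \<Rightarrow> 'z::complex_normed_vector) \<Rightarrow> bool"
  where "bounded_clinear T \<longleftrightarrow> bounded_linear T \<and> (\<forall>c x. T (c *\<^sub>C x) = c *\<^sub>C T x)"

text \<open>A partially defined operator is a domain \<open>D\<close> together with a total function \<open>A\<close> whose values
  outside \<open>D\<close> are never used.\<close>

definition linear_operator_on ::
  "'x::complex_normed_vector set \<Rightarrow> ('x \<Rightarrow> 'z::complex_normed_vector) \<Rightarrow> bool"
  where "linear_operator_on D A \<longleftrightarrow> complex_vector.subspace D
    \<and> (\<forall>x\<in>D. \<forall>y\<in>D. A (x + y) = A x + A y)
    \<and> (\<forall>c. \<forall>x\<in>D. A (c *\<^sub>C x) = c *\<^sub>C A x)"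

definition closed_operator_on ::
  "'x::complex_normed_vector set \<Rightarrow> ('x \<Rightarrow> 'z::complex_normed_vector) \<Rightarrow> bool"
  where "closed_operator_on D A \<longleftrightarrow> closed {(x, A x) | x. x \<in> D}"

definition densely_defined :: "'x::complex_normed_vector set \<Rightarrow> bool"
  where "densely_defined D \<longleftrightarrow> closure D = UNIV"

definition pencil ::
  "('x \<Rightarrow> 'z) \<Rightarrow> ('x \<Rightarrow> 'z) \<Rightarrow> complex \<Rightarrow> 'x \<Rightarrow> 'z::complex_normed_vector"
  where "pencil E A \<mu> x = \<mu> *\<^sub>C E x - A x"

definition resolvent ::
  "('x \<Rightarrow> 'z) \<Rightarrow> 'x set \<Rightarrow> ('x \<Rightarrow> 'z) \<Rightarrow> complex \<Rightarrow> 'z::complex_normed_vector \<Rightarrow> 'x"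
  where "resolvent E D A \<mu> = inv_into D (pencil E A \<mu>)"

definition resolvent_set ::
  "('x::complex_normed_vector \<Rightarrow> 'z::complex_normed_vector) \<Rightarrow> 'x set \<Rightarrow> ('x \<Rightarrow> 'z) \<Rightarrow> complex set"
  where "resolvent_set E D A =
    {\<mu>. bij_betw (pencil E A \<mu>) D UNIV \<and> bounded_clinear (resolvent E D A \<mu>)}"

text \<open>The families of regions over which the estimates are required: the ray \<open>(\<omega>, \<infinity>)\<close> for the
  real indices, the open right half-plane for the complex ones.\<close>

definition real_ray :: "real \<Rightarrow> complex set"
  where "real_ray \<omega> = complex_of_real ` {\<omega><..}"

definition half_plane :: "real \<Rightarrow> complex set"
  where "half_plane \<omega> = {\<mu>. Re \<mu> > \<omega>}"

text \<open>If \<open>p = 0\<close> and \<open>\<mu> = 0\<close>, then \<open>cmod \<mu> powi (int p - 1) = 0\<close>. This does not affect the existence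
  of suitable \<open>\<omega>\<close> and \<open>C\<close>, because \<open>\<omega>\<close> may always be enlarged so that \<open>0\<close> is outside the region.\<close>

definition resolvent_growth ::
  "(real \<Rightarrow> complex set) \<Rightarrow> ('x::complex_normed_vector \<Rightarrow> 'z::complex_normed_vector)
    \<Rightarrow> 'x set \<Rightarrow> ('x \<Rightarrow> 'z) \<Rightarrow> nat \<Rightarrow> bool"
  where "resolvent_growth \<Omega> E D A p \<longleftrightarrow>
    (\<exists>\<omega> C. C > 0 \<and> \<Omega> \<omega> \<subseteq> resolvent_set E D A
      \<and> (\<forall>\<mu>\<in>\<Omega> \<omega>. onorm (resolvent E D A \<mu>) \<le> C * cmod \<mu> powi (int p - 1)))"

text \<open>\<open>compose_seq T p\<close> is \<open>T 0 \<circ> T 1 \<circ> \<dots> \<circ> T p\<close>, with \<open>p + 1\<close> factors.\<close>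

definition compose_seq :: "(nat \<Rightarrow> 'a \<Rightarrow> 'a) \<Rightarrow> nat \<Rightarrow> 'a \<Rightarrow> 'a"
  where "compose_seq T p = foldr (\<lambda>k S. T k \<circ> S) [0..<Suc p] id"

definition radial ::
  "(real \<Rightarrow> complex set) \<Rightarrow> ('x::complex_normed_vector \<Rightarrow> 'z::complex_normed_vector)
    \<Rightarrow> 'x set \<Rightarrow> ('x \<Rightarrow> 'z) \<Rightarrow> nat \<Rightarrow> bool"
  where "radial \<Omega> E D A p \<longleftrightarrow>
    (\<exists>\<omega> C. C > 0 \<and> \<Omega> \<omega> \<subseteq> resolvent_set E D A
      \<and> (\<forall>\<mu>::nat \<Rightarrow> complex. (\<forall>k\<le>p. \<mu> k \<in> \<Omega> \<omega>) \<longrightarrow>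
          onorm (compose_seq (\<lambda>k. resolvent E D A (\<mu> k) \<circ> E) p)
            \<le> C * (\<Prod>k=0..p. 1 / cmod (\<mu> k - complex_of_real \<omega>))
        \<and> onorm (compose_seq (\<lambda>k. E \<circ> resolvent E D A (\<mu> k)) p)
            \<le> C * (\<Prod>k=0..p. 1 / cmod (\<mu> k - complex_of_real \<omega>))))"

text \<open>An index exists if some \<open>p\<close> satisfies the respective estimate; the index itself (a \<open>LEAST\<close>)
  is meaningful only in that case.\<close>

definition res_index_exists where
  "res_index_exists E D A \<longleftrightarrow> (\<exists>p. resolvent_growth real_ray E D A p)"

definition res_index where
  "res_index E D A = (LEAST p. resolvent_growth real_ray E D A p)"

definition complex_res_index_exists where
  "complex_res_index_exists E D A \<longleftrightarrow> (\<exists>p. resolvent_growth half_plane E D A p)"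

definition complex_res_index where
  "complex_res_index E D A = (LEAST p. resolvent_growth half_plane E D A p)"

definition rad_index_exists where
  "rad_index_exists E D A \<longleftrightarrow> (\<exists>p. radial real_ray E D A p)"

definition rad_index where
  "rad_index E D A = (LEAST p. radial real_ray E D A p)"

definition complex_rad_index_exists where
  "complex_rad_index_exists E D A \<longleftrightarrow> (\<exists>p. radial half_plane E D A p)"

definition complex_rad_index where
  "complex_rad_index E D A = (LEAST p. radial half_plane E D A p)"

end

theory Submission imports Defs begin

text \<open>Put \<open>R \<mu> = (\<mu>E - A)\<^sup>-\<^sup>1\<close> and fix the real point \<open>\<nu> = \<omega> + 1\<close>. Iterating the resolvent identity
  \<open>R \<mu> = R \<nu> + (\<nu> - \<mu>) R \<mu> E R \<nu>\<close> gives
  \<open>R \<mu> = (\<Sum>k\<le>p. (\<nu> - \<mu>)\<^sup>k (R \<nu> E)\<^sup>k R \<nu>) + (\<nu> - \<mu>)\<^sup>p\<^sup>+\<^sup>1 (R \<mu> E) (R \<nu> E)\<^sup>p R \<nu>\<close>.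
  The sum grows like \<open>|\<mu>|\<^sup>p\<close>, and by radiality with \<open>\<mu>\<^sub>0 = \<mu>\<close> and \<open>\<mu>\<^sub>1 = \<dots> = \<mu>\<^sub>p = \<nu>\<close> the
  remainder is at most a constant times \<open>|\<nu> - \<mu>|\<^sup>p\<^sup>+\<^sup>1 / |\<mu> - \<omega>|\<close>, which also grows like \<open>|\<mu>|\<^sup>p\<close>.\<close>

text \<open>Applying \<open>\<mu>E - A\<close> to \<open>x = R \<nu> z\<close> gives
  \<open>z + (\<mu> - \<nu>) E x\<close>. Since \<open>x\<close> lies in \<open>D\<close>, applying
  the linear map \<open>R \<mu>\<close> to this recovers \<open>x\<close>.\<close>

lemma resolvent_identity:
  assumes \<mu>: "\<mu> \<in> resolvent_set E D A" and \<nu>: "\<nu> \<in> resolvent_set E D A"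
  shows "resolvent E D A \<mu> z = resolvent E D A \<nu> z
    + (\<nu> - \<mu>) *\<^sub>C resolvent E D A \<mu> (E (resolvent E D A \<nu> z))"
proof -
  define x where "x = resolvent E D A \<nu> z"
  have surj: "z \<in> pencil E A \<nu> ` D"
    using \<nu> by (simp add: resolvent_set_def bij_betw_def)
  have "x \<in> D"
    unfolding x_def resolvent_def using surj by (rule inv_into_into)
  have "pencil E A \<nu> x = z"
    unfolding x_def resolvent_def using surj by (rule f_inv_into_f)
  then have "pencil E A \<mu> x = z + (\<mu> - \<nu>) *\<^sub>C E x"
    by (auto simp: pencil_def complex_vector.scale_left_diff_distrib)
  moreover have "resolvent E D A \<mu> (pencil E A \<mu> x) = x"
    using \<mu> \<open>x \<in> D\<close> by (simp add: resolvent_set_def resolvent_def bij_betw_def)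
  moreover have lin: "bounded_linear (resolvent E D A \<mu>)"
    "resolvent E D A \<mu> (c *\<^sub>C y) = c *\<^sub>C resolvent E D A \<mu> y" for c y
    using \<mu> by (auto simp: resolvent_set_def bounded_clinear_def)
  ultimately have "x = resolvent E D A \<mu> z + (\<mu> - \<nu>) *\<^sub>C resolvent E D A \<mu> (E x)"
    by (metis linear_simps(1))
  then show ?thesis
    unfolding x_def[symmetric]
    by (simp add: complex_vector.scale_left_diff_distrib algebra_simps)
qed

lemma resolvent_expansion:
  assumes "\<mu> \<in> resolvent_set E D A" "\<nu> \<in> resolvent_set E D A"
  shows "resolvent E D A \<mu> z =
    (\<Sum>k\<le>n. (\<nu> - \<mu>) ^ k *\<^sub>C ((resolvent E D A \<nu> \<circ> E) ^^ k) (resolvent E D A \<nu> z))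
    + (\<nu> - \<mu>) ^ Suc n *\<^sub>C
      resolvent E D A \<mu> (E (((resolvent E D A \<nu> \<circ> E) ^^ n) (resolvent E D A \<nu> z)))"
proof (induction n)
  case 0
  show ?case using resolvent_identity[OF assms, of z] by simp
next
  case (Suc n)
  show ?case
    \<comment> \<open>The identity is applied to the outer \<open>R \<mu>\<close> of the remainder.
      Its first term becomes the summand for \<open>k = Suc n\<close>, its second the new
      remainder.\<close>
    unfolding Suc.IH
    by (subst resolvent_identity[OF assms])
      (simp add: scaleC_add_right scaleC_scaleC mult.commute)
qed

text \<open>Matches the radiality product to the remainder of the expansion: of its
  \<open>p + 1\<close> factors, one contains \<open>R \<mu>\<close> and the other \<open>p\<close>
  are copies of \<open>R \<nu> E\<close>.\<close>

lemma compose_seq_eq_funpow: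
  assumes "\<And>k. 0 < k \<Longrightarrow> k \<le> p \<Longrightarrow> T k = S"
  shows "compose_seq T p = T 0 \<circ> S ^^ p"
proof -
  have "foldr (\<lambda>k F. T k \<circ> F) xs id = S ^^ length xs" if "\<forall>k\<in>set xs. T k = S" for xs
    using that by (induction xs) auto
  from this[of "[1..<Suc p]"] have "foldr (\<lambda>k F. T k \<circ> F) [1..<Suc p] id = S ^^ p"
    using assms by (auto simp del: upt_Suc)
  moreover have "[0..<Suc p] = 0 # [1..<Suc p]"
    using upt_conv_Cons[of 0 "Suc p"] by simp
  ultimately show ?thesis
    by (simp add: compose_seq_def del: upt_Suc)
qed

lemma bounded_linear_funpow:
  fixes T :: "'a::real_normed_vector \<Rightarrow> 'a"
  assumes "bounded_linear T"
  shows "bounded_linear (T ^^ n)"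
  by (induction n) (use assms in \<open>auto simp: id_def o_def intro: bounded_linear_compose\<close>)

text \<open>Treats the ray and the half-plane at once: \<open>mono\<close> permits shrinking the
  region, \<open>Re_gt\<close> gives lower bounds for moduli, and \<open>ray\<close> supplies the
  point \<open>\<nu>\<close>.\<close>

lemma resolvent_growth_if_radial:
  assumes E: "bounded_clinear E"
    and mono: "\<And>\<omega> \<omega>'. \<omega> \<le> \<omega>' \<Longrightarrow> \<Omega> \<omega>' \<subseteq> \<Omega> \<omega>"
    and Re_gt: "\<And>\<omega>. \<Omega> \<omega> \<subseteq> half_plane \<omega>"
    and ray: "\<And>\<omega>. real_ray \<omega> \<subseteq> \<Omega> \<omega>"
    and "radial \<Omega> E D A p"
  shows "resolvent_growth \<Omega> E D A (p + 1)"
proof -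
  define R where "R = resolvent E D A"
  obtain \<omega> C where "C > 0" and sub: "\<Omega> \<omega> \<subseteq> resolvent_set E D A"
    and rad: "\<And>\<mu>. \<forall>k\<le>p. \<mu> k \<in> \<Omega> \<omega> \<Longrightarrow> onorm (compose_seq (\<lambda>k. R (\<mu> k) \<circ> E) p)
      \<le> C * (\<Prod>k=0..p. 1 / cmod (\<mu> k - complex_of_real \<omega>))"
    using \<open>radial \<Omega> E D A p\<close> unfolding radial_def R_def by blast
  \<comment> \<open>At distance 1 from \<open>\<omega>\<close>, the point \<open>\<nu>\<close>
    contributes only factors 1 to the radiality bound.\<close>
  define \<nu> where "\<nu> = complex_of_real (\<omega> + 1)"
  have \<nu>: "\<nu> \<in> \<Omega> \<omega>"
    using ray[of \<omega>] unfolding \<nu>_def real_ray_def by (rule subsetD) (rule imageI, simp)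
  \<comment> \<open>On the smaller region both \<open>\<mu>\<close> and
    \<open>\<mu> - \<omega>\<close> have modulus at least 1.\<close>
  have shrink: "\<Omega> (\<bar>\<omega>\<bar> + 1) \<subseteq> \<Omega> \<omega>"
    by (rule mono) linarith
  have R_bl: "bounded_linear (R \<mu>)" if "\<mu> \<in> \<Omega> \<omega>" for \<mu>
    using sub that by (auto simp: resolvent_set_def bounded_clinear_def R_def)
  have RE_bl: "bounded_linear (R \<mu> \<circ> E)" if "\<mu> \<in> \<Omega> \<omega>" for \<mu>
    using R_bl[OF that] E by (auto simp: bounded_clinear_def o_def intro: bounded_linear_compose)
  define T where "T = R \<nu> \<circ> E"
  have T_bl: "bounded_linear (T ^^ k)" for k
    using RE_bl[OF \<nu>] by (simp add: T_def bounded_linear_funpow)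
  define K where "K k = onorm (\<lambda>z. (T ^^ k) (R \<nu> z))" for k
  have K_bl: "bounded_linear (\<lambda>z. (T ^^ k) (R \<nu> z))" for k
    using T_bl R_bl[OF \<nu>] by (rule bounded_linear_compose)
  have K_nonneg: "0 \<le> K k" for k
    unfolding K_def by (rule onorm_pos_le[OF K_bl])
  define m where "m = 1 + cmod \<nu>"
  \<comment> \<open>The sum controls the expansion terms, the next summand controls the remainder,
    and the final 1 makes \<open>M\<close> positive.\<close>
  define M where "M = (\<Sum>k\<le>p. m ^ k * K k) + 2 * C * m ^ p * onorm (R \<nu>) + 1"
  have "0 \<le> m" by (simp add: m_def)
  have "0 \<le> onorm (R \<nu>)" by (rule onorm_pos_le[OF R_bl[OF \<nu>]])
  have "M > 0"
    unfolding M_def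
    by (intro add_nonneg_pos add_nonneg_nonneg sum_nonneg mult_nonneg_nonneg)
      (use \<open>C > 0\<close> \<open>0 \<le> m\<close> \<open>0 \<le> onorm (R \<nu>)\<close> K_nonneg in auto)
  have bound: "onorm (R \<mu>) \<le> M * cmod \<mu> ^ p" if "\<mu> \<in> \<Omega> (\<bar>\<omega>\<bar> + 1)" for \<mu>
  proof (rule onorm_bound)
    show "0 \<le> M * cmod \<mu> ^ p" using \<open>M > 0\<close> by simp
  next
    fix z
    have \<mu>: "\<mu> \<in> \<Omega> \<omega>" using shrink that by blast
    have "Re \<mu> > \<bar>\<omega>\<bar> + 1" using Re_gt that by (auto simp: half_plane_def)
    then have "1 \<le> cmod \<mu>" "1 \<le> cmod (\<mu> - complex_of_real \<omega>)"
      using complex_Re_le_cmod[of \<mu>] complex_Re_le_cmod[of "\<mu> - complex_of_real \<omega>"] by auto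
    define d where "d = cmod (\<nu> - \<mu>)"
    have "d \<le> cmod \<nu> * 1 + cmod \<mu>"
      using norm_triangle_ineq4[of \<nu> \<mu>] by (simp add: d_def)
    also have "\<dots> \<le> cmod \<nu> * cmod \<mu> + cmod \<mu>"
      using \<open>1 \<le> cmod \<mu>\<close> by (intro add_right_mono mult_left_mono) auto
    finally have "d \<le> m * cmod \<mu>" by (simp add: m_def algebra_simps)
    then have d_pow: "d ^ k \<le> m ^ k * cmod \<mu> ^ k" for k
      using power_mono[of d "m * cmod \<mu>" k] by (simp add: d_def power_mult_distrib)
    \<comment> \<open>Here \<open>\<nu> - \<mu> = 1 - (\<mu> - \<omega>)\<close>.\<close>
    have "d \<le> cmod (\<mu> - complex_of_real \<omega>) + 1"
      using norm_triangle_ineq4[of 1 "\<mu> - complex_of_real \<omega>"]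
      by (simp add: d_def \<nu>_def algebra_simps)
    then have d_div: "d / cmod (\<mu> - complex_of_real \<omega>) \<le> 2"
      using \<open>1 \<le> cmod (\<mu> - complex_of_real \<omega>)\<close> by (simp add: divide_le_eq)

    define S where "S = (R \<mu> \<circ> E) \<circ> T ^^ p"
    define \<mu>s where "\<mu>s k = (if k = 0 then \<mu> else \<nu>)" for k :: nat
    have "compose_seq (\<lambda>k. R (\<mu>s k) \<circ> E) p = S"
      unfolding S_def T_def by (subst compose_seq_eq_funpow) (auto simp: \<mu>s_def)
    moreover have "(\<Prod>k=0..p. 1 / cmod (\<mu>s k - complex_of_real \<omega>))
        = 1 / cmod (\<mu> - complex_of_real \<omega>)"
      by (subst prod.atLeast_Suc_atMost) (auto simp: \<mu>s_def \<nu>_def)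
    ultimately have S_le: "onorm S \<le> C / cmod (\<mu> - complex_of_real \<omega>)"
      using rad[of \<mu>s] \<mu> \<nu> by (simp add: \<mu>s_def)
    have S_bl: "bounded_linear S"
      using bounded_linear_compose[OF RE_bl[OF \<mu>] T_bl] by (simp add: S_def o_def)

    \<comment> \<open>Lower powers are absorbed into the top one:
      \<open>cmod \<mu> ^ k \<le> cmod \<mu> ^ p\<close>, because
      \<open>1 \<le> cmod \<mu>\<close>.\<close>
    have "d ^ k * norm ((T ^^ k) (R \<nu> z)) \<le> m ^ k * K k * cmod \<mu> ^ p * norm z"
      if "k \<le> p" for k
    proof -
      have "d ^ k * norm ((T ^^ k) (R \<nu> z)) \<le> (m ^ k * cmod \<mu> ^ p) * (K k * norm z)"
      proof (intro mult_mono)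
        show "d ^ k \<le> m ^ k * cmod \<mu> ^ p"
          using d_pow[of k] \<open>0 \<le> m\<close> power_increasing[OF that \<open>1 \<le> cmod \<mu>\<close>]
          by (meson mult_left_mono order_trans zero_le_power)
        show "norm ((T ^^ k) (R \<nu> z)) \<le> K k * norm z"
          unfolding K_def by (rule onorm[OF K_bl])
      qed (use \<open>0 \<le> m\<close> in auto)
      then show ?thesis by (simp add: mult_ac)
    qed
    then have sum_le: "(\<Sum>k\<le>p. d ^ k * norm ((T ^^ k) (R \<nu> z)))
        \<le> (\<Sum>k\<le>p. m ^ k * K k) * cmod \<mu> ^ p * norm z"
      unfolding sum_distrib_right by (intro sum_mono) auto

    have "norm (S (R \<nu> z)) \<le> onorm S * norm (R \<nu> z)"
      by (rule onorm[OF S_bl])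
    also have "\<dots> \<le> C / cmod (\<mu> - complex_of_real \<omega>) * (onorm (R \<nu>) * norm z)"
      using S_le onorm[OF R_bl[OF \<nu>], of z] \<open>C > 0\<close> by (intro mult_mono) auto
    finally have "d ^ Suc p * norm (S (R \<nu> z))
        \<le> d ^ Suc p * (C / cmod (\<mu> - complex_of_real \<omega>) * (onorm (R \<nu>) * norm z))"
      by (rule mult_left_mono) (simp add: d_def)
    \<comment> \<open>One of the \<open>p + 1\<close> factors \<open>d\<close> is spent against the
      radiality denominator, so only growth of order \<open>p\<close> remains.\<close>
    also have "\<dots> = d ^ p * (d / cmod (\<mu> - complex_of_real \<omega>)) * (C * onorm (R \<nu>) * norm z)"
      by simp
    also have "\<dots> \<le> m ^ p * cmod \<mu> ^ p * 2 * (C * onorm (R \<nu>) * norm z)"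
      using d_pow[of p] d_div \<open>0 \<le> m\<close> \<open>C > 0\<close> \<open>0 \<le> onorm (R \<nu>)\<close>
      by (intro mult_right_mono mult_mono) (auto simp: d_def)
    finally have rem_le: "d ^ Suc p * norm (S (R \<nu> z))
        \<le> 2 * C * m ^ p * onorm (R \<nu>) * cmod \<mu> ^ p * norm z"
      by (simp add: mult_ac)

    have "R \<mu> z = (\<Sum>k\<le>p. (\<nu> - \<mu>) ^ k *\<^sub>C (T ^^ k) (R \<nu> z)) + (\<nu> - \<mu>) ^ Suc p *\<^sub>C S (R \<nu> z)"
      using resolvent_expansion[of \<mu> E D A \<nu> z p] \<mu> \<nu> sub by (auto simp: R_def T_def S_def)
    then have "norm (R \<mu> z) \<le> norm (\<Sum>k\<le>p. (\<nu> - \<mu>) ^ k *\<^sub>C (T ^^ k) (R \<nu> z))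
        + norm ((\<nu> - \<mu>) ^ Suc p *\<^sub>C S (R \<nu> z))"
      using norm_triangle_ineq by metis
    also have "\<dots> \<le> (\<Sum>k\<le>p. d ^ k * norm ((T ^^ k) (R \<nu> z))) + d ^ Suc p * norm (S (R \<nu> z))"
      by (intro add_mono order_trans[OF norm_sum] sum_mono)
        (simp_all add: norm_scaleC norm_power norm_mult d_def)
    also have "\<dots> \<le> (M - 1) * cmod \<mu> ^ p * norm z"
      using sum_le rem_le by (simp add: M_def algebra_simps)
    also have "\<dots> \<le> M * cmod \<mu> ^ p * norm z"
      by (intro mult_right_mono) auto
    finally show "norm (R \<mu> z) \<le> M * cmod \<mu> ^ p * norm z" .
  qed
  have "\<Omega> (\<bar>\<omega>\<bar> + 1) \<subseteq> resolvent_set E D A"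
    using sub shrink by blast
  \<comment> \<open>The required exponent is \<open>int (p + 1) - 1 = int p\<close>, so
    \<open>powi\<close> becomes the natural power in \<open>bound\<close>.\<close>
  then show ?thesis
    unfolding resolvent_growth_def using \<open>M > 0\<close> bound
    by (intro exI[of _ "\<bar>\<omega>\<bar> + 1"] exI[of _ M]) (auto simp: R_def)
qed

theorem proposition5p4:
  fixes E A :: "'x::{complex_normed_vector, banach} \<Rightarrow> 'z::{complex_normed_vector, banach}"
    and D :: "'x set"
  assumes "bounded_clinear E"
    and "linear_operator_on D A"
    and "closed_operator_on D A"
    and "densely_defined D"
    and "resolvent_set E D A \<noteq> {}"
  shows "(rad_index_exists E D A \<longrightarrow>
            res_index_exists E D A \<and> rad_index E D A + 1 \<ge> res_index E D A)
       \<and> (complex_rad_index_exists E D A \<longrightarrow>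
            complex_res_index_exists E D A \<and> complex_rad_index E D A + 1 \<ge> complex_res_index E D A)"
proof -
  have real: "resolvent_growth real_ray E D A (p + 1)" if "radial real_ray E D A p" for p
    by (rule resolvent_growth_if_radial[OF assms(1) _ _ _ that])
      (auto simp: real_ray_def half_plane_def)
  have complex: "resolvent_growth half_plane E D A (p + 1)" if "radial half_plane E D A p" for p
    by (rule resolvent_growth_if_radial[OF assms(1) _ _ _ that])
      (auto simp: real_ray_def half_plane_def)
  \<comment> \<open>Once an index exists, its \<open>LEAST\<close> value satisfies the radiality
    estimate itself. The growth estimate then holds one step higher, which bounds the least growth
    exponent.\<close>
  have "resolvent_growth real_ray E D A (rad_index E D A + 1)" if "rad_index_exists E D A"
    using that real unfolding rad_index_exists_def rad_index_def by (blast intro: LeastI)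
  moreover have "resolvent_growth half_plane E D A (complex_rad_index E D A + 1)"
    if "complex_rad_index_exists E D A"
    using that complex unfolding complex_rad_index_exists_def complex_rad_index_def
    by (blast intro: LeastI)
  ultimately show ?thesis
    unfolding res_index_exists_def complex_res_index_exists_def res_index_def complex_res_index_def
    by (blast intro: Least_le)
qed

end
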